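(* Fix the particle number $N$ and the Hamiltonian $\hat H^{(0)}=\hat K+\hat U$ (kinetic plus interaction energy) of an $N$-electron gas. For an external potential $v:\mathbb R^3\to\mathbb R$, let $F_v(\beta;n]$ be the intrinsic density functional potential $$F_v(\beta;n]=\langle \hat K+\hat U\rangle-\frac{S_v}{\beta},$$ where the expectation $\langle\cdot\rangle$ and the trial entropy $S_v$ are taken in the trial density matrix with inverse temperature $\beta$ and expected particle density $n$ (for the Hamiltonian with external potential $v$). Then $F_v$ is a functional of the density $n(x)$ (at given $\beta$) and is independent of the external potential $v(x)$: $$\frac{\delta F_v(\beta;n]}{\delta v(x')}=0\qquad\text{for fixed }\beta\text{ and fixed }n(x).$$
   Context: The system is a non-relativistic gas of a fixed number $N$ of electrons; its Hilbert space is the antisymmetrized $N$-fold tensor product of the one-particle space of two-component spinor wave functions on $\mathbb R^3$. The Hamiltonian with external potential $v$ is $$\hat H_v=\hat K+\hat U+\hat V,\qquad \hat K=\sum_{i=1}^N\hat p_i^2,\quad \hat U=\frac12\sum_{j\ne k}\frac1{|\hat x_j-\hat x_k|},\quad \hat V=\sum_{l=1}^N v(\hat x_l)$$ (units are chosen so that constants are suppressed). The density operator at the point $x\in\mathbb R^3$ is $\hat n_x=\sum_{i=1}^N\delta(\hat x_i-x)$, so that $\int d^3x\,\alpha(x)\hat n_x=\sum_i\alpha(\hat x_i)$ for a function $\alpha$ on $\mathbb R^3$. For a density matrix $\hat\rho$ (positive, $Tr\hat\rho=1$), $\langle \hat A\rangle=Tr(\hat\rho\hat A)$. Trial density matrices.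 For inverse temperature $\beta>0$ and a function $\alpha:\mathbb R^3\to\mathbb R$ put $$\hat\rho_n=\frac1{Z_v(\beta;\alpha]}\,e^{-\beta\hat H_v-\int d^3x\,\alpha(x)\hat n_x},\qquad Z_v(\beta;\alpha]=Tr\, e^{-\beta\hat H_v-\int d^3x\,\alpha(x)\hat n_x}.$$ Its expected density is $n(x)=\langle\hat n_x\rangle=-\frac{\delta \log Z_v(\beta;\alpha]}{\delta\alpha(x)}$, and it satisfies $\int d^3x\,n(x)=N$. Given $\beta$, $v$ and $n$, the multiplier function $\alpha$ is the one determined implicitly by this relation; adding a constant to $\alpha$ does not change $\hat\rho_n$. With $E=\langle\hat H_v\rangle$, the trial entropy is $$S_v=-Tr(\hat\rho_n\log\hat\rho_n)=\beta E+\int d^3x\,\alpha(x)n(x)+\log Z_v(\beta;\alpha].$$ The notation $F_v(\beta;n]$ means a function of $\beta$ and a functional of the function $n$. All statements concern those $v,\beta,n$ for which the trial density matrix exists and the displayed quantities are well defined and finite. *)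

theory Defs
  imports "HOL-Analysis.Analysis"
begin

section \<open>Smooth functions and locally square integrable potentials\<close>

definition pd :: "'a::euclidean_space \<Rightarrow> ('a \<Rightarrow> 'b::real_normed_vector) \<Rightarrow> 'a \<Rightarrow> 'b" where
  "pd b f x = frechet_derivative f (at x) b"

definition smooth :: "('a::euclidean_space \<Rightarrow> 'b::real_normed_vector) \<Rightarrow> bool" where
  "smooth f \<longleftrightarrow> (\<forall>bs x. set bs \<subseteq> Basis \<longrightarrow> foldr pd bs f differentiable (at x))"

definition test_function :: "('a::euclidean_space \<Rightarrow> 'b::real_normed_vector) \<Rightarrow> bool" where
  "test_function f \<longleftrightarrow> smooth f \<and> compact (closure {x. f x \<noteq> 0})"

text \<open>Potentials and multiplier functions are taken locally square integrable: this is exactly what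
  makes multiplication by them map test functions into the Hilbert space, and it allows Coulomb
  singularities.\<close>

definition L2_loc :: "(real^3 \<Rightarrow> real) \<Rightarrow> bool" where
  "L2_loc v \<longleftrightarrow> v \<in> borel_measurable borel \<and>
     (\<forall>K. compact K \<longrightarrow> set_integrable lborel K (\<lambda>x. (v x)\<^sup>2))"


section \<open>The Hilbert space of the electrons\<close>

text \<open>The electrons are labelled by a finite type \<open>'n\<close>, so their number is \<open>CARD('n)\<close>.
  The \<open>N\<close>-fold tensor power of two-component spinor wave functions on three-dimensional space is
  realised as usual by square integrable functions of \<open>N\<close> spins and \<open>N\<close> positions. Wave functions
  are represented by functions, and equality in the Hilbert space is equality almost everywhere
  (\<open>weq\<close>).\<close>

type_synonym 'n wave = "('n \<Rightarrow> bool) \<Rightarrow> real^3^'n \<Rightarrow> complex"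

definition hilb :: "'n::finite wave set" where
  "hilb = {\<psi>. (\<forall>\<sigma>. \<psi> \<sigma> \<in> borel_measurable borel \<and> integrable lborel (\<lambda>x. (cmod (\<psi> \<sigma> x))\<^sup>2)) \<and>
     (\<forall>p \<sigma>. p permutes UNIV \<longrightarrow>
        (AE x in lborel. \<psi> (\<sigma> \<circ> p) (\<chi> i. x $ p i) = of_int (sign p) * \<psi> \<sigma> x))}"

definition weq :: "'n::finite wave \<Rightarrow> 'n wave \<Rightarrow> bool" where
  "weq \<phi> \<psi> \<longleftrightarrow> (\<forall>\<sigma>. AE x in lborel. \<phi> \<sigma> x = \<psi> \<sigma> x)"

definition lincomb :: "complex \<Rightarrow> 'n::finite wave \<Rightarrow> complex \<Rightarrow> 'n wave \<Rightarrow> 'n wave" where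
  "lincomb a \<phi> b \<psi> = (\<lambda>\<sigma> x. a * \<phi> \<sigma> x + b * \<psi> \<sigma> x)"

definition ip :: "'n::finite wave \<Rightarrow> 'n wave \<Rightarrow> complex" where
  "ip \<phi> \<psi> = (\<Sum>\<sigma>\<in>UNIV. \<integral>x. cnj (\<phi> \<sigma> x) * \<psi> \<sigma> x \<partial>lborel)"

definition wnorm :: "'n::finite wave \<Rightarrow> real" where
  "wnorm \<psi> = sqrt (Re (ip \<psi> \<psi>))"

definition wdist :: "'n::finite wave \<Rightarrow> 'n wave \<Rightarrow> real" where
  "wdist \<phi> \<psi> = wnorm (lincomb 1 \<phi> (-1) \<psi>)"

text \<open>The Hilbert space is separable and infinite dimensional, hence bases indexed by \<open>nat\<close>.\<close>

definition onb :: "(nat \<Rightarrow> 'n::finite wave) \<Rightarrow> bool" where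
  "onb e \<longleftrightarrow> range e \<subseteq> hilb \<and>
     (\<forall>j k. ip (e j) (e k) = (if j = k then 1 else 0)) \<and>
     (\<forall>\<psi>\<in>hilb. (\<forall>k. ip (e k) \<psi> = 0) \<longrightarrow> weq \<psi> (\<lambda>\<sigma> x. 0))"


section \<open>Operators\<close>

text \<open>Operators, possibly unbounded, are represented by their graphs. The graphs of closed operators
  below contain all representatives of the functions concerned. The product \<open>A B\<close> of operators is
  the relational composition \<open>B O A\<close>.\<close>

type_synonym 'n oper = "('n wave \<times> 'n wave) set"

definition app :: "'n::finite oper \<Rightarrow> 'n wave \<Rightarrow> 'n wave" where
  "app A \<psi> = (SOME \<xi>. (\<psi>, \<xi>) \<in> A)"

definition scale_oper :: "complex \<Rightarrow> 'n::finite oper \<Rightarrow> 'n oper" where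
  "scale_oper c A = {(\<psi>, \<lambda>\<sigma> x. c * \<xi> \<sigma> x) | \<psi> \<xi>. (\<psi>, \<xi>) \<in> A}"

definition closure_oper :: "'n::finite oper \<Rightarrow> 'n oper" where
  "closure_oper A = {(\<psi>, \<xi>). \<psi> \<in> hilb \<and> \<xi> \<in> hilb \<and>
     (\<exists>f g. (\<forall>k::nat. (f k, g k) \<in> A) \<and>
        (\<lambda>k. wdist (f k) \<psi>) \<longlonglongrightarrow> 0 \<and> (\<lambda>k. wdist (g k) \<xi>) \<longlonglongrightarrow> 0)}"

definition adjoint_oper :: "'n::finite oper \<Rightarrow> 'n oper" where
  "adjoint_oper A = {(\<phi>, \<xi>). \<phi> \<in> hilb \<and> \<xi> \<in> hilb \<and> (\<forall>(\<psi>, \<zeta>)\<in>A. ip \<phi> \<zeta> = ip \<xi> \<psi>)}"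

definition densely_defined :: "'n::finite oper \<Rightarrow> bool" where
  "densely_defined A \<longleftrightarrow> (\<forall>\<phi>\<in>hilb. \<forall>\<epsilon>>0. \<exists>\<psi>\<in>Domain A. wdist \<phi> \<psi> < \<epsilon>)"

definition self_adjoint :: "'n::finite oper \<Rightarrow> bool" where
  "self_adjoint A \<longleftrightarrow> densely_defined A \<and> adjoint_oper A = A"

definition bounded_oper :: "'n::finite oper \<Rightarrow> bool" where
  "bounded_oper A \<longleftrightarrow> Domain A = hilb \<and> Range A \<subseteq> hilb \<and>
     (\<forall>(\<psi>, \<xi>)\<in>A. \<forall>(\<psi>', \<xi>')\<in>A. \<forall>a b. (lincomb a \<psi> b \<psi>', lincomb a \<xi> b \<xi>') \<in> A) \<and>
     (\<exists>C. \<forall>(\<psi>, \<xi>)\<in>A. wnorm \<xi> \<le> C * wnorm \<psi>)"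


section \<open>Functional calculus of self-adjoint operators\<close>

definition projection_valued_measure :: "(real set \<Rightarrow> 'n::finite oper) \<Rightarrow> bool" where
  "projection_valued_measure E \<longleftrightarrow>
     (\<forall>B\<in>sets borel. bounded_oper (E B) \<and> self_adjoint (E B) \<and> E B O E B = E B) \<and>
     E UNIV = {(\<psi>, \<xi>). \<psi> \<in> hilb \<and> \<xi> \<in> hilb \<and> weq \<psi> \<xi>} \<and>
     (\<forall>\<psi>\<in>hilb. \<forall>B::nat \<Rightarrow> real set. range B \<subseteq> sets borel \<and> disjoint_family B \<longrightarrow>
        (\<lambda>k. ip \<psi> (app (E (B k)) \<psi>)) sums ip \<psi> (app (E (\<Union>k. B k)) \<psi>))"

definition diag_measure :: "(real set \<Rightarrow> 'n::finite oper) \<Rightarrow> 'n wave \<Rightarrow> real measure" where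
  "diag_measure E \<psi> = measure_of UNIV (sets borel) (\<lambda>B. ennreal (Re (ip \<psi> (app (E B) \<psi>))))"

text \<open>The operator \<open>\<integral> f dE\<close>, with domain the \<open>\<psi>\<close> for which \<open>\<bar>f\<bar>\<^sup>2\<close> is integrable with respect to
  \<open>\<langle>\<psi>, E \<psi>\<rangle>\<close>; its off-diagonal matrix elements are given by polarization (\<open>ip\<close> is antilinear in
  its first argument).\<close>

definition pvm_domain :: "(real \<Rightarrow> real) \<Rightarrow> (real set \<Rightarrow> 'n::finite oper) \<Rightarrow> 'n wave set" where
  "pvm_domain f E = {\<psi>\<in>hilb. integrable (diag_measure E \<psi>) (\<lambda>t. (f t)\<^sup>2)}"

definition pvm_integral :: "(real \<Rightarrow> real) \<Rightarrow> (real set \<Rightarrow> 'n::finite oper) \<Rightarrow> 'n oper" where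
  "pvm_integral f E = {(\<psi>, \<xi>). \<psi> \<in> pvm_domain f E \<and> \<xi> \<in> hilb \<and>
     (\<forall>\<phi>\<in>pvm_domain f E. ip \<phi> \<xi> =
        (\<Sum>k<4. \<i> ^ k * of_real (\<integral>t. f t \<partial>diag_measure E (lincomb 1 \<psi> (\<i> ^ k) \<phi>))) / 4)}"

definition spectral_measure :: "'n::finite oper \<Rightarrow> real set \<Rightarrow> 'n oper" where
  "spectral_measure A = (SOME E. projection_valued_measure E \<and> pvm_integral (\<lambda>t. t) E = A)"

definition fun_of_oper :: "(real \<Rightarrow> real) \<Rightarrow> 'n::finite oper \<Rightarrow> 'n oper" where
  "fun_of_oper f A = pvm_integral f (spectral_measure A)"


section \<open>Trace\<close>

definition abs_oper :: "'n::finite oper \<Rightarrow> 'n oper" where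
  "abs_oper A = fun_of_oper sqrt (A O adjoint_oper A)"

definition trace_class :: "'n::finite oper \<Rightarrow> bool" where
  "trace_class A \<longleftrightarrow> bounded_oper A \<and>
     (\<exists>e. onb e \<and> summable (\<lambda>k. Re (ip (e k) (app (abs_oper A) (e k)))))"

definition trace_oper :: "'n::finite oper \<Rightarrow> complex" where
  "trace_oper A = (let e = (SOME e. onb e) in \<Sum>k. ip (e k) (app A (e k)))"


section \<open>The Hamiltonian\<close>

text \<open>The operators are first defined on antisymmetric test functions and then closed.\<close>

definition core :: "'n::finite wave set" where
  "core = {\<psi>. (\<forall>\<sigma>. test_function (\<psi> \<sigma>)) \<and>
     (\<forall>p \<sigma> x. p permutes UNIV \<longrightarrow> \<psi> (\<sigma> \<circ> p) (\<chi> i. x $ p i) = of_int (sign p) * \<psi> \<sigma> x)}"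

definition momentum :: "'n::finite \<Rightarrow> 3 \<Rightarrow> 'n wave \<Rightarrow> 'n wave" where
  "momentum i a \<psi> = (\<lambda>\<sigma> x. - \<i> * pd (axis i (axis a 1)) (\<psi> \<sigma>) x)"

definition kinetic :: "'n::finite wave \<Rightarrow> 'n wave" where
  "kinetic \<psi> = (\<lambda>\<sigma> x. \<Sum>i\<in>UNIV. \<Sum>a\<in>UNIV. momentum i a (momentum i a \<psi>) \<sigma> x)"

definition interaction :: "real^3^'n::finite \<Rightarrow> real" where
  "interaction x = 1/2 * (\<Sum>j\<in>UNIV. \<Sum>k\<in>UNIV - {j}. 1 / norm (x $ j - x $ k))"

definition one_body :: "(real^3 \<Rightarrow> real) \<Rightarrow> real^3^'n::finite \<Rightarrow> real" where
  "one_body a x = (\<Sum>i\<in>UNIV. a (x $ i))"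

definition hamiltonian :: "(real^3 \<Rightarrow> real) \<Rightarrow> 'n::finite wave \<Rightarrow> 'n wave" where
  "hamiltonian v \<psi> = (\<lambda>\<sigma> x. kinetic \<psi> \<sigma> x + of_real (interaction x) * \<psi> \<sigma> x
                                            + of_real (one_body v x) * \<psi> \<sigma> x)"

definition intrinsic_hamiltonian :: "'n::finite oper" where
  "intrinsic_hamiltonian = closure_oper
     {(\<psi>, \<lambda>\<sigma> x. kinetic \<psi> \<sigma> x + of_real (interaction x) * \<psi> \<sigma> x) | \<psi>. \<psi> \<in> core}"

text \<open>Multiplication by \<open>\<Sum>i. a (x $ i)\<close>, that is, the density operator integrated against \<open>a\<close>.\<close>

definition one_body_oper :: "(real^3 \<Rightarrow> real) \<Rightarrow> 'n::finite oper" where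
  "one_body_oper a = {(\<psi>, \<xi>). \<psi> \<in> hilb \<and> \<xi> \<in> hilb \<and>
     weq \<xi> (\<lambda>\<sigma> x. of_real (one_body a x) * \<psi> \<sigma> x)}"


section \<open>Trial density matrices\<close>

definition gibbs_exponent :: "real \<Rightarrow> (real^3 \<Rightarrow> real) \<Rightarrow> (real^3 \<Rightarrow> real) \<Rightarrow> 'n::finite oper" where
  "gibbs_exponent \<beta> v \<alpha> = closure_oper
     {(\<psi>, \<lambda>\<sigma> x. - of_real \<beta> * hamiltonian v \<psi> \<sigma> x - of_real (one_body \<alpha> x) * \<psi> \<sigma> x) | \<psi>. \<psi> \<in> core}"

definition boltzmann :: "real \<Rightarrow> (real^3 \<Rightarrow> real) \<Rightarrow> (real^3 \<Rightarrow> real) \<Rightarrow> 'n::finite oper" where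
  "boltzmann \<beta> v \<alpha> = fun_of_oper exp (gibbs_exponent \<beta> v \<alpha>)"

definition gibbs :: "real \<Rightarrow> (real^3 \<Rightarrow> real) \<Rightarrow> (real^3 \<Rightarrow> real) \<Rightarrow> 'n::finite oper" where
  "gibbs \<beta> v \<alpha> = (let B = boltzmann \<beta> v \<alpha> in scale_oper (1 / trace_oper B) B)"

text \<open>For an unbounded observable \<open>A\<close>, the trace \<open>Tr (\<rho> A)\<close> is understood as that of the everywhere
  defined operator \<open>A \<rho>\<close>.\<close>

definition has_expectation :: "'n::finite oper \<Rightarrow> 'n oper \<Rightarrow> bool" where
  "has_expectation \<rho> A \<longleftrightarrow> trace_class (\<rho> O A)"

definition expectation :: "'n::finite oper \<Rightarrow> 'n oper \<Rightarrow> real" where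
  "expectation \<rho> A = Re (trace_oper (\<rho> O A))"

definition has_density :: "'n::finite oper \<Rightarrow> (real^3 \<Rightarrow> real) \<Rightarrow> bool" where
  "has_density \<rho> n \<longleftrightarrow> integrable lborel n \<and>
     (\<forall>a\<in>borel_measurable borel. bounded (range a) \<longrightarrow>
        has_expectation \<rho> (one_body_oper a) \<and>
        expectation \<rho> (one_body_oper a) = (\<integral>x. a x * n x \<partial>lborel))"

definition is_trial ::
  "real \<Rightarrow> (real^3 \<Rightarrow> real) \<Rightarrow> (real^3 \<Rightarrow> real) \<Rightarrow> 'n::finite oper \<Rightarrow> bool" where
  "is_trial \<beta> v n \<rho> \<longleftrightarrow> (\<exists>\<alpha>. L2_loc \<alpha> \<and>
     self_adjoint (gibbs_exponent \<beta> v \<alpha> :: 'n oper) \<and>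
     trace_class (boltzmann \<beta> v \<alpha> :: 'n oper) \<and>
     \<rho> = gibbs \<beta> v \<alpha> \<and> has_density \<rho> n)"

definition trial :: "real \<Rightarrow> (real^3 \<Rightarrow> real) \<Rightarrow> (real^3 \<Rightarrow> real) \<Rightarrow> 'n::finite oper" where
  "trial \<beta> v n = (THE \<rho>. is_trial \<beta> v n \<rho>)"

definition entropy :: "'n::finite oper \<Rightarrow> real" where
  "entropy \<rho> = - expectation \<rho> (fun_of_oper ln \<rho>)"

definition intrinsic_potential ::
  "'n::finite itself \<Rightarrow> real \<Rightarrow> (real^3 \<Rightarrow> real) \<Rightarrow> (real^3 \<Rightarrow> real) \<Rightarrow> real" where
  "intrinsic_potential _ \<beta> v n =
     (let \<rho> = trial \<beta> v n :: 'n oper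
      in expectation \<rho> intrinsic_hamiltonian - entropy \<rho> / \<beta>)"

text \<open>The potentials for which, at given \<open>\<beta>\<close> and \<open>n\<close>, the trial density matrix is determined by
  \<open>n\<close> and the quantities in \<open>intrinsic_potential\<close> are well defined and finite. The multiplier
  itself can be determined only up to an additive constant, which does not affect the density
  matrix.\<close>

definition admissible ::
  "'n::finite itself \<Rightarrow> real \<Rightarrow> (real^3 \<Rightarrow> real) \<Rightarrow> (real^3 \<Rightarrow> real) set" where
  "admissible _ \<beta> n = {v. L2_loc v \<and> (\<exists>!\<rho> :: 'n oper. is_trial \<beta> v n \<rho>) \<and>
     has_expectation (trial \<beta> v n :: 'n oper) intrinsic_hamiltonian \<and>
     has_expectation (trial \<beta> v n :: 'n oper) (fun_of_oper ln (trial \<beta> v n))}"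


section \<open>Functional derivatives\<close>

text \<open>\<open>g\<close> is the functional derivative at \<open>v\<close> of a functional \<open>F\<close> with domain \<open>D\<close>.\<close>

definition has_functional_derivative ::
  "((real^3 \<Rightarrow> real) \<Rightarrow> real) \<Rightarrow> (real^3 \<Rightarrow> real) set \<Rightarrow> (real^3 \<Rightarrow> real) \<Rightarrow> (real^3 \<Rightarrow> real) \<Rightarrow> bool" where
  "has_functional_derivative F D v g \<longleftrightarrow> v \<in> D \<and>
     (\<forall>\<eta>. test_function \<eta> \<longrightarrow>
        (\<forall>\<^sub>F \<epsilon> in nhds 0. (\<lambda>x. v x + \<epsilon> * \<eta> x) \<in> D) \<and>
        integrable lborel (\<lambda>x. g x * \<eta> x) \<and>
        ((\<lambda>\<epsilon>. F (\<lambda>x. v x + \<epsilon> * \<eta> x)) has_real_derivative (\<integral>x. g x * \<eta> x \<partial>lborel)) (at 0))"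

end

theory Submission
  imports Defs
begin

text \<open>The Gibbs exponent depends on \<open>v\<close> and \<open>\<alpha>\<close> only through \<open>\<beta> v + \<alpha>\<close>, so a change of the
  potential is absorbed by the multiplier \<open>\<alpha> + \<beta> (v - w)\<close>. Hence the trial density matrix of given
  \<open>\<beta>\<close> and density is the same for all potentials, and so is the expectation defining the intrinsic
  potential.\<close>

lemma L2_loc_add:
  assumes "L2_loc f" and "L2_loc g"
  shows "L2_loc (\<lambda>x. f x + g x)"
  unfolding L2_loc_def
proof (intro conjI allI impI)
  have [measurable]: "f \<in> borel_measurable borel" "g \<in> borel_measurable borel"
    using assms by (auto simp: L2_loc_def)
  show "(\<lambda>x. f x + g x) \<in> borel_measurable borel" by measurable
  fix K :: "(real^3) set"
  assume "compact K"
  then have [measurable]: "K \<in> sets borel" by (simp add: borel_compact)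
  have "set_integrable lborel K (\<lambda>x. 2 * (f x)\<^sup>2 + 2 * (g x)\<^sup>2)"
    using assms \<open>compact K\<close> by (auto simp: L2_loc_def intro!: set_integral_add)
  then show "set_integrable lborel K (\<lambda>x. (f x + g x)\<^sup>2)"
  proof (rule set_integrable_bound)
    show "set_borel_measurable lborel K (\<lambda>x. (f x + g x)\<^sup>2)"
      unfolding set_borel_measurable_def by measurable
    \<comment> \<open>The two sides differ by the square of \<open>s - t\<close>.\<close>
    have "(s + t)\<^sup>2 \<le> 2 * s\<^sup>2 + 2 * t\<^sup>2" for s t :: real
      using sum_squares_ge_zero[of "s - t" 0] by (simp add: power2_eq_square algebra_simps)
    then show "AE x in lborel. x \<in> K \<longrightarrow> norm ((f x + g x)\<^sup>2) \<le> norm (2 * (f x)\<^sup>2 + 2 * (g x)\<^sup>2)"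
      by simp
  qed
qed

lemma L2_loc_cmult:
  assumes "L2_loc f"
  shows "L2_loc (\<lambda>x. c * f x)"
  using assms by (auto simp: L2_loc_def power_mult_distrib)

lemma L2_loc_continuous:
  assumes "continuous_on UNIV f"
  shows "L2_loc f"
  unfolding L2_loc_def set_integrable_def
proof (intro conjI allI impI)
  show "f \<in> borel_measurable borel"
    using assms by (rule borel_measurable_continuous_onI)
  show "integrable lborel (\<lambda>x. indicat_real K x *\<^sub>R (f x)\<^sup>2)" if "compact K" for K
    using that continuous_on_subset[OF assms]
    by (intro borel_integrable_compact continuous_intros) auto
qed

lemma test_function_continuous:
  assumes "test_function f"
  shows "continuous_on UNIV f"
proof -
  have "f differentiable (at x)" for x
    using assms unfolding test_function_def smooth_def
    by (metis empty_set empty_subsetI foldr_Nil id_apply)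
  then show ?thesis
    by (simp add: continuous_at_imp_continuous_on differentiable_imp_continuous_within)
qed

text \<open>The graphs on \<open>core\<close> already agree function by function before the closure
  is taken, so no question about domains of sums of unbounded operators arises.\<close>

lemma gibbs_exponent_shift:
  "gibbs_exponent \<beta> w (\<lambda>x. \<alpha> x + \<beta> * (v x - w x)) = (gibbs_exponent \<beta> v \<alpha> :: 'n::finite oper)"
proof -
  have "one_body (\<lambda>y. \<alpha> y + \<beta> * (v y - w y)) x
      = one_body \<alpha> x + \<beta> * (one_body v x - one_body w x)" for x :: "real^3^'n"
    by (simp add: one_body_def sum.distrib sum_subtractf flip: sum_distrib_left)
  then show ?thesis
    \<comment> \<open>The linearity of \<open>one_body\<close> is applied first, before
      \<open>algebra_simps\<close> can rearrange the function inside it.\<close>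
    unfolding gibbs_exponent_def hamiltonian_def by (simp only:) (simp add: algebra_simps)
qed

lemma is_trial_change_potential:
  assumes v: "L2_loc v" and w: "L2_loc w" and "is_trial \<beta> v n (\<rho> :: 'n::finite oper)"
  shows "is_trial \<beta> w n \<rho>"
proof -
  obtain \<alpha> where \<alpha>: "L2_loc \<alpha>" "self_adjoint (gibbs_exponent \<beta> v \<alpha> :: 'n oper)"
    "trace_class (boltzmann \<beta> v \<alpha> :: 'n oper)" "\<rho> = gibbs \<beta> v \<alpha>" "has_density \<rho> n"
    using assms(3) unfolding is_trial_def by blast
  let ?\<alpha> = "\<lambda>x. \<alpha> x + \<beta> * (v x - w x)"
  \<comment> \<open>Spectral and trace conditions carry over with the operator itself; only the
    local square integrability of the new multiplier has to be checked.\<close>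
  have "L2_loc (\<lambda>x. v x + (-1) * w x)"
    by (intro L2_loc_add L2_loc_cmult v w)
  then have "L2_loc ?\<alpha>"
    by (intro L2_loc_add L2_loc_cmult \<alpha>(1)) simp
  moreover have "boltzmann \<beta> w ?\<alpha> = (boltzmann \<beta> v \<alpha> :: 'n oper)"
    by (simp only: boltzmann_def gibbs_exponent_shift)
  moreover from this have "gibbs \<beta> w ?\<alpha> = (gibbs \<beta> v \<alpha> :: 'n oper)"
    by (simp only: gibbs_def)
  ultimately show ?thesis
    unfolding is_trial_def using \<alpha> gibbs_exponent_shift[where 'n = 'n] by metis
qed

lemma is_trial_independent:
  assumes "L2_loc v" and "L2_loc w"
  shows "is_trial \<beta> v n = (is_trial \<beta> w n :: 'n::finite oper \<Rightarrow> bool)"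
  using assms is_trial_change_potential by blast

text \<open>\<open>THE\<close> is applied to equal predicates, so the two values agree even where no
  unique trial density matrix exists.\<close>

lemma trial_independent:
  assumes "L2_loc v" and "L2_loc w"
  shows "trial \<beta> v n = (trial \<beta> w n :: 'n::finite oper)"
  by (simp only: trial_def is_trial_independent[OF assms])

lemma intrinsic_potential_independent:
  assumes "L2_loc v" and "L2_loc w"
  shows "intrinsic_potential TYPE('n::finite) \<beta> v n = intrinsic_potential TYPE('n) \<beta> w n"
  by (simp only: intrinsic_potential_def trial_independent[OF assms])

text \<open>Apart from \<open>L2_loc\<close>, admissibility sees the potential only through
  \<open>is_trial\<close> and \<open>trial\<close>. This keeps perturbed potentials in the domain on
  which the functional derivative is taken.\<close>

lemma admissible_change_potential:
  assumes "v \<in> admissible TYPE('n::finite) \<beta> n" and w: "L2_loc w"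
  shows "w \<in> admissible TYPE('n) \<beta> n"
proof -
  have v: "L2_loc v" using assms(1) by (simp add: admissible_def)
  show ?thesis
    using assms unfolding admissible_def
    by (simp add: is_trial_independent[OF v w] trial_independent[OF v w])
qed

theorem theorem9:
  fixes \<beta> :: real
  assumes "0 < \<beta>"
  shows "(\<exists>\<Phi> :: (real^3 \<Rightarrow> real) \<Rightarrow> real. \<forall>n. \<forall>v \<in> admissible TYPE('n::finite) \<beta> n.
            intrinsic_potential TYPE('n) \<beta> v n = \<Phi> n) \<and>
         (\<forall>n. \<forall>v \<in> admissible TYPE('n) \<beta> n.
            has_functional_derivative (\<lambda>v. intrinsic_potential TYPE('n) \<beta> v n)
              (admissible TYPE('n) \<beta> n) v (\<lambda>x'. 0))"
proof (intro conjI allI ballI)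
  have zero: "L2_loc (\<lambda>x. 0)" by (simp add: L2_loc_continuous)
  show "\<exists>\<Phi>. \<forall>n. \<forall>v \<in> admissible TYPE('n) \<beta> n. intrinsic_potential TYPE('n) \<beta> v n = \<Phi> n"
    \<comment> \<open>The zero potential serves as reference: being in \<open>L2_loc\<close> is
      enough for the comparison, whether or not it is admissible for \<open>n\<close>.\<close>
    by (intro exI[of _ "\<lambda>n. intrinsic_potential TYPE('n) \<beta> (\<lambda>x. 0) n"] allI ballI
        intrinsic_potential_independent zero) (simp add: admissible_def)
next
  fix n v
  assume adm: "v \<in> admissible TYPE('n) \<beta> n"
  then have v: "L2_loc v" by (simp add: admissible_def)
  have L2: "L2_loc (\<lambda>x. v x + \<epsilon> * \<eta> x)" if "test_function \<eta>" for \<eta> \<epsilon>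
    using that by (intro L2_loc_add L2_loc_cmult L2_loc_continuous test_function_continuous v)
  \<comment> \<open>Along the whole line through \<open>v\<close> in direction \<open>\<eta>\<close>
    the functional keeps its value at \<open>v\<close>, so this is the derivative of a
    constant.\<close>
  have "((\<lambda>\<epsilon>. intrinsic_potential TYPE('n) \<beta> (\<lambda>x. v x + \<epsilon> * \<eta> x) n) has_real_derivative 0) (at 0)"
    if "test_function \<eta>" for \<eta>
    by (simp add: intrinsic_potential_independent[OF L2[OF that] v])
  then show "has_functional_derivative (\<lambda>v. intrinsic_potential TYPE('n) \<beta> v n)
      (admissible TYPE('n) \<beta> n) v (\<lambda>x'. 0)"
    unfolding has_functional_derivative_def
    using adm admissible_change_potential[OF adm L2] by simp
qed

end
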